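(* For every positive even integer $k$, every connected, false twin-free and total $k$-uniform graph is regular.
   Context: All graphs are finite and simple. $N(v)$ is the set of neighbors of $v$. Two distinct vertices $u,v$ are false twins if $N(u)=N(v)$; a graph is false twin-free if it has no false twins. For a graph $G$ with no isolated vertices, a total dominating set is a set $A\subseteq V(G)$ such that every vertex of $G$ has a neighbor in $A$; $\gamma_t(G)$ is the minimum size of one. A sequence $(v_1,\dots,v_m)$ of distinct vertices is legal if $N(v_i)\setminus\bigcup_{j=1}^{i-1}N(v_j)\neq\emptyset$ for every $i\in\{2,\dots,m\}$; it is a total dominating sequence if moreover $\{v_1,\dots,v_m\}$ is a total dominating set. $\gamma_{gr}^t(G)$ is the maximum length of a total dominating sequence. $G$ is total $k$-uniform if $\gamma_t(G)=\gamma_{gr}^t(G)=k$. *)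

theory Defs
  imports "Graph_Theory.Digraph_Component"
begin

text \<open>Finite simple graphs are the symmetric, loop-free digraphs without multiple arcs of
  the locale \<^locale>\<open>graph\<close>: an edge is a pair of opposite arcs.\<close>

definition nbhd :: "('a, 'b) pre_digraph \<Rightarrow> 'a \<Rightarrow> 'a set" where
  "nbhd G v = {u. v \<rightarrow>\<^bsub>G\<^esub> u}"

definition false_twins :: "('a, 'b) pre_digraph \<Rightarrow> 'a \<Rightarrow> 'a \<Rightarrow> bool" where
  "false_twins G u v \<longleftrightarrow> u \<in> verts G \<and> v \<in> verts G \<and> u \<noteq> v \<and> nbhd G u = nbhd G v"

definition false_twin_free :: "('a, 'b) pre_digraph \<Rightarrow> bool" where
  "false_twin_free G \<longleftrightarrow> \<not> (\<exists>u v. false_twins G u v)"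

definition no_isolated :: "('a, 'b) pre_digraph \<Rightarrow> bool" where
  "no_isolated G \<longleftrightarrow> (\<forall>v \<in> verts G. nbhd G v \<noteq> {})"

definition total_dominating_set :: "('a, 'b) pre_digraph \<Rightarrow> 'a set \<Rightarrow> bool" where
  "total_dominating_set G A \<longleftrightarrow> A \<subseteq> verts G \<and> (\<forall>v \<in> verts G. nbhd G v \<inter> A \<noteq> {})"

definition total_domination_number :: "('a, 'b) pre_digraph \<Rightarrow> nat" where
  "total_domination_number G = Min (card ` {A. total_dominating_set G A})"

text \<open>Positions are counted from 0, so the first vertex is \<open>vs ! 0\<close> and is unconstrained.\<close>

definition legal_sequence :: "('a, 'b) pre_digraph \<Rightarrow> 'a list \<Rightarrow> bool" where
  "legal_sequence G vs \<longleftrightarrow> set vs \<subseteq> verts G \<and> distinct vs \<and>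
     (\<forall>i. 1 \<le> i \<and> i < length vs \<longrightarrow> nbhd G (vs ! i) - (\<Union>j<i. nbhd G (vs ! j)) \<noteq> {})"

definition total_dominating_sequence :: "('a, 'b) pre_digraph \<Rightarrow> 'a list \<Rightarrow> bool" where
  "total_dominating_sequence G vs \<longleftrightarrow> legal_sequence G vs \<and> total_dominating_set G (set vs)"

definition grundy_total_domination_number :: "('a, 'b) pre_digraph \<Rightarrow> nat" where
  "grundy_total_domination_number G = Max (length ` {vs. total_dominating_sequence G vs})"

text \<open>Both numbers are only meaningful for graphs without isolated vertices (otherwise
  \<^const>\<open>Min\<close> and \<^const>\<open>Max\<close> are taken over the empty set), so this is part of the notion.\<close>

definition total_uniform :: "nat \<Rightarrow> ('a, 'b) pre_digraph \<Rightarrow> bool" where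
  "total_uniform k G \<longleftrightarrow> no_isolated G \<and>
     total_domination_number G = k \<and> grundy_total_domination_number G = k"

definition regular :: "('a, 'b) pre_digraph \<Rightarrow> bool" where
  "regular G \<longleftrightarrow> (\<exists>d. \<forall>v \<in> verts G. card (nbhd G v) = d)"

lemma (in graph) card_nbhd: "card (nbhd G v) = out_degree G v"
proof -
  have "nbhd G v = head G ` out_arcs G v"
    by (auto simp: nbhd_def arcs_ends_conv)
  moreover have "inj_on (head G) (out_arcs G v)"
    by (auto intro!: inj_onI no_multi_arcs simp: arc_to_ends_def)
  ultimately show ?thesis
    by (simp add: out_degree_def card_image)
qed

lemma (in graph) finite_total_dominating_sets: "finite {A. total_dominating_set G A}"
  by (rule finite_subset[of _ "Pow (verts G)"]) (auto simp: total_dominating_set_def)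

lemma (in graph) finite_total_dominating_sequences: "finite {vs. total_dominating_sequence G vs}"
  by (rule finite_subset[OF _ finite_subset_distinct[OF finite_verts]])
    (auto simp: total_dominating_sequence_def legal_sequence_def)

end

theory Submission
  imports Defs
begin

text \<open>Uniformity makes \<open>S \<mapsto> {v. N(v) \<subseteq> N(S)}\<close> a matroid closure of rank \<open>k\<close> on the vertices, and
  non-adjacency is a polarity of its lattice of flats, which is therefore modular; the hyperplanes
  are the sets of non-neighbours of single vertices. Projecting from a common neighbour \<open>p\<close> of
  \<open>u\<close> and \<open>v\<close> is a bijection between the corresponding hyperplanes, so \<open>u\<close> and \<open>v\<close> have equal
  degree. By connectedness, a non-regular graph would be bipartite with distinct degrees \<open>a < b\<close> on
  its two parts. Then the biadjacency matrix has a kernel vector on the larger part, but a function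
  with zero sum on all hyperplanes and on the whole vertex set has, by descending induction,
  zero sum on every flat, in particular on every single vertex.\<close>

section \<open>Underdetermined homogeneous linear systems\<close>

lemma homogeneous_system_nontrivial_solution:
  fixes M :: "'b \<Rightarrow> 'a \<Rightarrow> real"
  assumes "finite B" and "finite A" and "card B < card A"
  shows "\<exists>f. (\<exists>v\<in>A. f v \<noteq> 0) \<and> (\<forall>q\<in>B. (\<Sum>v\<in>A. M q v * f v) = 0)"
  using assms
proof (induction B arbitrary: A M rule: finite_induct)
  case empty
  then obtain v where "v \<in> A" by fastforce
  then show ?case by (intro exI[of _ "\<lambda>_. 1"]) auto
next
  case (insert q B)
  show ?case
  proof (cases "\<forall>v\<in>A. M q v = 0")
    case True
    have "card B < card A" using insert.prems insert.hyps by simp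
    from insert.IH[OF insert.prems(1) this, of M]
    obtain f where "\<exists>v\<in>A. f v \<noteq> 0" "\<forall>r\<in>B. (\<Sum>v\<in>A. M r v * f v) = 0" by blast
    moreover have "(\<Sum>v\<in>A. M q v * f v) = 0" using True by simp
    ultimately show ?thesis by blast
  next
    case False
    then obtain w where w: "w \<in> A" "M q w \<noteq> 0" by blast
    \<comment> \<open>Gaussian elimination with pivot \<open>M q w\<close>: column \<open>w\<close>
      of \<open>M'\<close> vanishes, and \<open>c\<close> below solves row \<open>q\<close> for the
      value at \<open>w\<close>.\<close>
    define M' where "M' r v = M r v - M r w * M q v / M q w" for r v
    have "card B < card (A - {w})" using insert.prems insert.hyps w by simp
    from insert.IH[OF _ this, of M'] insert.prems(1)
    obtain f where f: "\<exists>v\<in>A - {w}. f v \<noteq> 0"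
      "\<And>r. r \<in> B \<Longrightarrow> (\<Sum>v\<in>A - {w}. M' r v * f v) = 0" by auto
    define c where "c = - (\<Sum>v\<in>A - {w}. M q v * f v) / M q w"
    define g where "g = f(w := c)"
    have split: "(\<Sum>v\<in>A. M r v * g v) = M r w * c + (\<Sum>v\<in>A - {w}. M r v * f v)" for r
      using insert.prems(1) w(1) by (simp add: sum.remove[of A w] g_def)
    have "(\<Sum>v\<in>A. M q v * g v) = 0"
      using w(2) by (simp add: split c_def)
    moreover have "(\<Sum>v\<in>A. M r v * g v) = 0" if "r \<in> B" for r
    proof -
      have "0 = (\<Sum>v\<in>A - {w}. M' r v * f v)" using f(2)[OF that] by simp
      also have "\<dots> = (\<Sum>v\<in>A - {w}. M r v * f v - M r w / M q w * (M q v * f v))"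
        by (intro sum.cong) (auto simp: M'_def field_simps)
      also have "\<dots> = (\<Sum>v\<in>A - {w}. M r v * f v) + M r w * c"
        by (simp only: sum_subtractf sum_distrib_left[symmetric] c_def) simp
      finally show ?thesis by (simp add: split)
    qed
    moreover have "\<exists>v\<in>A. g v \<noteq> 0" using f(1) by (auto simp: g_def)
    ultimately show ?thesis by (intro exI[of _ g]) auto
  qed
qed

section \<open>Legal sequences and the bounds given by uniformity\<close>

locale total_uniform_graph = graph G for G :: "('a, 'b) pre_digraph" +
  fixes k :: nat
  assumes twin_free: "false_twin_free G" and uniform: "total_uniform k G"
begin

abbreviation nbhds :: "'a set \<Rightarrow> 'a set" where
  "nbhds S \<equiv> (\<Union>v\<in>S. nbhd G v)"

lemma nbhd_sym: "u \<in> nbhd G v \<longleftrightarrow> v \<in> nbhd G u"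
  using sym_arcs by (auto simp: nbhd_def symmetric_def dest: symD)

lemma nbhd_subset: "nbhd G v \<subseteq> verts G"
  by (auto simp: nbhd_def)

lemma in_verts_if_nbhd: "u \<in> nbhd G v \<Longrightarrow> u \<in> verts G" "u \<in> nbhd G v \<Longrightarrow> v \<in> verts G"
  by (auto simp: nbhd_def)

lemma finite_nbhd: "finite (nbhd G v)"
  using finite_subset[OF nbhd_subset finite_verts] .

lemma nbhd_nonempty: "v \<in> verts G \<Longrightarrow> nbhd G v \<noteq> {}"
  using uniform by (simp add: total_uniform_def no_isolated_def)

lemma total_dominating_set_iff:
  "total_dominating_set G A \<longleftrightarrow> A \<subseteq> verts G \<and> verts G \<subseteq> nbhds A"
proof -
  have "nbhd G v \<inter> A \<noteq> {} \<longleftrightarrow> v \<in> nbhds A" for v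
    using nbhd_sym by blast
  then show ?thesis unfolding total_dominating_set_def by blast
qed

lemma k_le_card_if_dominating:
  assumes "A \<subseteq> verts G" "verts G \<subseteq> nbhds A"
  shows "k \<le> card A"
proof -
  have "Min (card ` {A. total_dominating_set G A}) \<le> card A"
    using assms finite_total_dominating_sets by (intro Min_le) (auto simp: total_dominating_set_iff)
  then show ?thesis
    using uniform by (simp add: total_uniform_def total_domination_number_def)
qed

lemma legal_sequence_Nil: "legal_sequence G []"
  by (simp add: legal_sequence_def)

text \<open>Neighbourhoods are nonempty, so the unconstrained first vertex meets the same condition
  as the later ones; a new neighbour also forces distinctness.\<close>

lemma legal_sequence_snoc:
  "legal_sequence G (vs @ [v]) \<longleftrightarrow>
    legal_sequence G vs \<and> v \<in> verts G \<and> \<not> nbhd G v \<subseteq> nbhds (set vs)"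
proof -
  have U: "(\<Union>j<i. nbhd G ((vs @ [v]) ! j)) = (\<Union>j<i. nbhd G (vs ! j))" if "i \<le> length vs" for i
    using that by (intro SUP_cong) (auto simp: nth_append)
  have set: "(\<Union>j<length vs. nbhd G (vs ! j)) = nbhds (set vs)"
    by (auto simp: set_conv_nth)
  have "(\<forall>i. 1 \<le> i \<and> i < length (vs @ [v]) \<longrightarrow>
      nbhd G ((vs @ [v]) ! i) - (\<Union>j<i. nbhd G ((vs @ [v]) ! j)) \<noteq> {}) \<longleftrightarrow>
    (\<forall>i. 1 \<le> i \<and> i < length vs \<longrightarrow> nbhd G (vs ! i) - (\<Union>j<i. nbhd G (vs ! j)) \<noteq> {}) \<and>
    (vs \<noteq> [] \<longrightarrow> nbhd G v - nbhds (set vs) \<noteq> {})" (is "?L \<longleftrightarrow> ?R")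
  proof
    assume L: ?L
    have "nbhd G (vs ! i) - (\<Union>j<i. nbhd G (vs ! j)) \<noteq> {}" if "1 \<le> i" "i < length vs" for i
      using L[rule_format, of i] that U[of i] by (simp add: nth_append)
    moreover have "nbhd G v - nbhds (set vs) \<noteq> {}" if "vs \<noteq> []"
      using L[rule_format, of "length vs"] that U[of "length vs"] set by (simp add: Suc_le_eq)
    ultimately show ?R by blast
  next
    assume R: ?R
    show ?L
    proof (intro allI impI)
      fix i assume i: "1 \<le> i \<and> i < length (vs @ [v])"
      show "nbhd G ((vs @ [v]) ! i) - (\<Union>j<i. nbhd G ((vs @ [v]) ! j)) \<noteq> {}"
      proof (cases "i = length vs")
        case True
        then show ?thesis using R i U[of i] set by auto
      next
        case False
        then show ?thesis using R i U[of i] by (simp add: nth_append)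
      qed
    qed
  qed
  moreover have "nbhd G v - nbhds (set vs) \<noteq> {}" if "vs = []" "v \<in> verts G"
    using that nbhd_nonempty by simp
  ultimately show ?thesis unfolding legal_sequence_def by auto
qed

text \<open>Greedy choice inside \<open>W\<close>: each added vertex dominates something new. From
  the empty list this yields a basis of \<open>W\<close>.\<close>

lemma legal_sequence_extend:
  assumes "legal_sequence G vs" "set vs \<subseteq> W" "W \<subseteq> verts G"
  shows "\<exists>ws. legal_sequence G (vs @ ws) \<and> set ws \<subseteq> W \<and> nbhds W \<subseteq> nbhds (set (vs @ ws))"
  using assms
proof (induction "card (verts G - nbhds (set vs))" arbitrary: vs rule: less_induct)
  case less
  show ?case
  proof (cases "nbhds W \<subseteq> nbhds (set vs)")
    case True
    then show ?thesis using less.prems by (intro exI[of _ "[]"]) simp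
  next
    case False
    then obtain w u where w: "w \<in> W" "u \<in> nbhd G w" "u \<notin> nbhds (set vs)" by blast
    then have "legal_sequence G (vs @ [w])"
      using less.prems by (auto simp: legal_sequence_snoc)
    moreover have "card (verts G - nbhds (set (vs @ [w]))) < card (verts G - nbhds (set vs))"
      using w in_verts_if_nbhd by (intro psubset_card_mono) auto
    moreover have "set (vs @ [w]) \<subseteq> W" using w less.prems by simp
    ultimately obtain ws where "legal_sequence G ((vs @ [w]) @ ws)" "set ws \<subseteq> W"
      "nbhds W \<subseteq> nbhds (set ((vs @ [w]) @ ws))"
      using less.hyps less.prems(3) by blast
    then show ?thesis using w(1) by (intro exI[of _ "w # ws"]) simp
  qed
qed

lemma nbhds_verts: "nbhds (verts G) = verts G"
proof -
  have "v \<in> nbhds (verts G)" if "v \<in> verts G" for v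
    using nbhd_nonempty[OF that] nbhd_sym in_verts_if_nbhd by blast
  then show ?thesis using nbhd_subset by blast
qed

lemma legal_sequence_extend_dominating:
  assumes "legal_sequence G vs"
  shows "\<exists>ws. legal_sequence G (vs @ ws) \<and> total_dominating_set G (set (vs @ ws))"
proof -
  have "set vs \<subseteq> verts G" using assms by (simp add: legal_sequence_def)
  then obtain ws where ws: "legal_sequence G (vs @ ws)" "verts G \<subseteq> nbhds (set (vs @ ws))"
    using legal_sequence_extend[OF assms _ order_refl] nbhds_verts by auto
  then show ?thesis unfolding total_dominating_set_iff legal_sequence_def by blast
qed

lemma length_dominating_sequence_le:
  assumes "legal_sequence G vs" "total_dominating_set G (set vs)"
  shows "length vs \<le> k"
proof -
  have "length vs \<le> Max (length ` {vs. total_dominating_sequence G vs})"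
    using assms finite_total_dominating_sequences
    by (intro Max_ge) (auto simp: total_dominating_sequence_def)
  then show ?thesis
    using uniform by (simp add: total_uniform_def grundy_total_domination_number_def)
qed

text \<open>Upper half of uniformity, freed from domination; \<open>k_le_card_if_dominating\<close>
  is the lower half.\<close>

lemma length_legal_sequence_le:
  assumes "legal_sequence G vs"
  shows "length vs \<le> k"
  using legal_sequence_extend_dominating[OF assms] length_dominating_sequence_le by fastforce

section \<open>The exchange axiom and its first consequences\<close>

text \<open>The closure operator \<open>S \<mapsto> {v. N(v) \<subseteq> N(S)}\<close> satisfies the exchange axiom: otherwise
  some dominating sequence through \<open>S, w, v\<close> would stay dominating after dropping \<open>w\<close>.\<close>

lemma nbhd_exchange:
  assumes S: "S \<subseteq> verts G" and v: "v \<in> verts G" and w: "w \<in> verts G"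
    and sub: "nbhd G w \<subseteq> nbhd G v \<union> nbhds S" and new: "\<not> nbhd G w \<subseteq> nbhds S"
  shows "nbhd G v \<subseteq> nbhd G w \<union> nbhds S"
proof (rule ccontr)
  assume neg: "\<not> nbhd G v \<subseteq> nbhd G w \<union> nbhds S"
  \<comment> \<open>A legal list with the neighbourhood of \<open>S\<close> makes the two lengths
    comparable.\<close>
  obtain ss where ss: "legal_sequence G ss" "set ss \<subseteq> S" "nbhds S \<subseteq> nbhds (set ss)"
    using legal_sequence_extend[OF legal_sequence_Nil _ S] by auto
  have eq: "nbhds (set ss) = nbhds S" using ss by auto
  have "legal_sequence G (ss @ [w])"
    using ss w new eq by (simp add: legal_sequence_snoc)
  moreover have "\<not> nbhd G v \<subseteq> nbhds (set (ss @ [w]))"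
    using neg eq by auto
  ultimately have "legal_sequence G ((ss @ [w]) @ [v])"
    using v legal_sequence_snoc by blast
  then obtain ts where ts: "legal_sequence G (((ss @ [w]) @ [v]) @ ts)"
      "total_dominating_set G (set (((ss @ [w]) @ [v]) @ ts))"
    using legal_sequence_extend_dominating by blast
  have "verts G \<subseteq> nbhds (set (ss @ [v] @ ts))"
    using ts(2) sub eq unfolding total_dominating_set_iff by auto
  moreover have "set (ss @ [v] @ ts) \<subseteq> verts G"
    using ts(2) unfolding total_dominating_set_iff by auto
  ultimately have "k \<le> card (set (ss @ [v] @ ts))" by (rule k_le_card_if_dominating[rotated])
  also have "\<dots> \<le> length (ss @ [v] @ ts)" by (rule card_length)
  finally show False using length_legal_sequence_le[OF ts(1)] by simp
qed

text \<open>Exchange over the empty set turns inclusion into equality, which twin-freeness excludes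
  for distinct vertices: the matroid is simple.\<close>

lemma nbhd_antichain:
  assumes "v \<in> verts G" "w \<in> verts G" "nbhd G w \<subseteq> nbhd G v"
  shows "w = v"
proof -
  have "nbhd G v \<subseteq> nbhd G w"
    using nbhd_exchange[of "{}" v w] assms nbhd_nonempty[of w] by simp
  then show ?thesis
    using twin_free assms unfolding false_twin_free_def false_twins_def by blast
qed

lemma nbhd_exchange_line:
  assumes "v \<in> verts G" "w \<in> verts G" "p \<in> verts G" "w \<noteq> p"
    and "nbhd G w \<subseteq> nbhd G v \<union> nbhd G p"
  shows "nbhd G v \<subseteq> nbhd G w \<union> nbhd G p"
  using nbhd_exchange[of "{p}" v w] assms nbhd_antichain[of p w] by auto

section \<open>Modularity from reversed sequences\<close>

text \<open>Witnesses of a legal sequence, read backwards, form a legal sequence again.\<close>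

lemma legal_sequence_reversal:
  assumes "legal_sequence G ws" "legal_sequence G ss" "nbhds (set ss) \<inter> set ws = {}"
  shows "\<exists>zs. legal_sequence G zs \<and> length zs = length ss + length ws"
  using assms
proof (induction ws arbitrary: ss rule: rev_induct)
  case Nil
  then show ?case by auto
next
  case (snoc w ws)
  then have ws: "legal_sequence G ws" "\<not> nbhd G w \<subseteq> nbhds (set ws)"
    by (auto simp: legal_sequence_snoc)
  then obtain z where z: "z \<in> nbhd G w" "z \<notin> nbhds (set ws)" by blast
  have "legal_sequence G (ss @ [z])"
  proof -
    have "w \<in> nbhd G z" "w \<notin> nbhds (set ss)" using z snoc.prems(3) nbhd_sym[of z w] by auto
    then have "\<not> nbhd G z \<subseteq> nbhds (set ss)" by blast
    then show ?thesis
      using snoc.prems(2) in_verts_if_nbhd(1)[OF z(1)] by (simp add: legal_sequence_snoc)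
  qed
  \<comment> \<open>\<open>ss\<close> collects the witnesses read so far; \<open>z\<close> has no
    neighbour in \<open>ws\<close>, so disjointness survives.\<close>
  moreover have "nbhds (set (ss @ [z])) \<inter> set ws = {}"
  proof -
    have "nbhd G z \<inter> set ws = {}" using z(2) nbhd_sym by blast
    then show ?thesis using snoc.prems(3) by auto
  qed
  ultimately obtain zs where "legal_sequence G zs" "length zs = length (ss @ [z]) + length ws"
    using snoc.IH[OF ws(1)] by blast
  then show ?case by (intro exI[of _ zs]) simp
qed

text \<open>In the matroid, every line meets every hyperplane; this is the modularity that comes from
  the self-duality of the lattice of flats.\<close>

lemma line_meets_hyperplane:
  assumes x: "x \<in> verts G" and p: "p \<in> verts G" and v: "v \<in> verts G" and "x \<noteq> p"
  shows "\<exists>y\<in>verts G. nbhd G y \<subseteq> nbhd G x \<union> nbhd G p \<and> y \<notin> nbhd G v"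
proof (rule ccontr)
  assume neg: "\<not> ?thesis"
  \<comment> \<open>A vertex lies on the line through \<open>x\<close> and \<open>p\<close> exactly
    if it has no neighbour in \<open>W\<close>. If that line lies inside \<open>nbhd G v\<close>,
    then \<open>v # ws\<close> dominates.\<close>
  define W where "W = verts G - (nbhd G x \<union> nbhd G p)"
  obtain ws where ws: "legal_sequence G ws" "set ws \<subseteq> W" "nbhds W \<subseteq> nbhds (set ws)"
    using legal_sequence_extend[OF legal_sequence_Nil, of W] by (auto simp: W_def)
  have "verts G \<subseteq> nbhds (set (v # ws))"
  proof
    fix y assume y: "y \<in> verts G"
    show "y \<in> nbhds (set (v # ws))"
    proof (cases "y \<in> nbhd G v")
      case False
      with neg y obtain w where w: "w \<in> nbhd G y" "w \<notin> nbhd G x \<union> nbhd G p" by blast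
      then have "w \<in> W" "y \<in> nbhd G w" using in_verts_if_nbhd nbhd_sym by (auto simp: W_def)
      then show ?thesis using ws(3) by auto
    qed simp
  qed
  moreover have "set (v # ws) \<subseteq> verts G" using v ws(2) by (auto simp: W_def)
  ultimately have "k \<le> card (set (v # ws))" by (rule k_le_card_if_dominating[rotated])
  then have "k \<le> Suc (length ws)" using card_length[of "v # ws"] by simp
  \<comment> \<open>Reversing \<open>ws\<close> after \<open>p\<close>, \<open>x\<close> gives a
    legal sequence of length \<open>length ws + 2\<close>, which exceeds \<open>k\<close>.\<close>
  moreover have "legal_sequence G (([] @ [p]) @ [x])"
    using x p \<open>x \<noteq> p\<close> nbhd_antichain[of p x] nbhd_nonempty[of p]
    by (simp only: legal_sequence_snoc legal_sequence_Nil) auto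
  then have "\<exists>zs. legal_sequence G zs \<and> length zs = length (([] @ [p]) @ [x]) + length ws"
    using ws by (intro legal_sequence_reversal) (auto simp: W_def)
  ultimately show False using length_legal_sequence_le by fastforce
qed

section \<open>Degrees of vertices with a common neighbour\<close>

text \<open>Perspectivity from \<open>p\<close> between the hyperplanes of non-neighbours of \<open>u\<close> and of \<open>v\<close>.\<close>

lemma card_nbhd_diff_le:
  assumes up: "u \<in> nbhd G p" and vp: "v \<in> nbhd G p"
  shows "card (nbhd G v - nbhd G u) \<le> card (nbhd G u - nbhd G v)"
proof -
  have V: "u \<in> verts G" "v \<in> verts G" "p \<in> verts G" using assms in_verts_if_nbhd by auto
  \<comment> \<open>\<open>y\<close> is a point where the line through \<open>x\<close> and
    \<open>p\<close> meets the hyperplane of non-neighbours of \<open>v\<close>.\<close>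
  define Q where "Q x y \<longleftrightarrow> y \<in> verts G \<and> nbhd G y \<subseteq> nbhd G x \<union> nbhd G p \<and> y \<notin> nbhd G v" for x y
  have step: "y \<in> nbhd G u - nbhd G v" "nbhd G x \<subseteq> nbhd G y \<union> nbhd G p"
    if x: "x \<in> nbhd G v - nbhd G u" and y: "Q x y" for x y
  proof -
    have xV: "x \<in> verts G" and yV: "y \<in> verts G" using x y in_verts_if_nbhd by (auto simp: Q_def)
    have "y \<noteq> p" "y \<noteq> x" using x y vp nbhd_sym by (auto simp: Q_def)
    show "nbhd G x \<subseteq> nbhd G y \<union> nbhd G p"
      using nbhd_exchange_line[OF xV yV V(3) \<open>y \<noteq> p\<close>] y by (auto simp: Q_def)
    have "nbhd G p \<subseteq> nbhd G y \<union> nbhd G x"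
      using nbhd_exchange_line[OF V(3) yV xV \<open>y \<noteq> x\<close>] y by (auto simp: Q_def)
    then have "u \<in> nbhd G y" using up x nbhd_sym by blast
    then show "y \<in> nbhd G u - nbhd G v" using y nbhd_sym by (auto simp: Q_def)
  qed
  have "\<exists>y. Q x y" if "x \<in> nbhd G v - nbhd G u" for x
  proof -
    have "x \<noteq> p" using that up nbhd_sym by blast
    then show ?thesis
      using line_meets_hyperplane[of x p v] that V in_verts_if_nbhd by (auto simp: Q_def)
  qed
  then obtain h where h: "\<And>x. x \<in> nbhd G v - nbhd G u \<Longrightarrow> Q x (h x)" by metis
  have "inj_on h (nbhd G v - nbhd G u)"
  proof (rule inj_onI, rule ccontr)
    fix x x' assume x: "x \<in> nbhd G v - nbhd G u" and x': "x' \<in> nbhd G v - nbhd G u"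
      and eq: "h x = h x'" and ne: "x \<noteq> x'"
    \<comment> \<open>Two preimages of one point would have \<open>p\<close> on their line; but
      neither is adjacent to \<open>u\<close>, whereas \<open>p\<close> is.\<close>
    have "nbhd G x' \<subseteq> nbhd G (h x) \<union> nbhd G p" using step(2)[OF x' h[OF x']] eq by simp
    moreover have "nbhd G (h x) \<subseteq> nbhd G x \<union> nbhd G p" using h[OF x] by (simp add: Q_def)
    ultimately have "nbhd G x' \<subseteq> nbhd G p \<union> nbhd G x" by blast
    then have "nbhd G p \<subseteq> nbhd G x' \<union> nbhd G x"
      using nbhd_exchange_line[of p x' x] V x x' ne in_verts_if_nbhd by blast
    then show False using up x x' nbhd_sym by blast
  qed
  moreover have "h ` (nbhd G v - nbhd G u) \<subseteq> nbhd G u - nbhd G v" using step(1) h by blast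
  ultimately show ?thesis using finite_nbhd by (intro card_inj_on_le) auto
qed

lemma card_nbhd_eq_if_common_nbhd:
  assumes "u \<in> nbhd G p" "v \<in> nbhd G p"
  shows "card (nbhd G u) = card (nbhd G v)"
proof -
  have "card (nbhd G v - nbhd G u) = card (nbhd G u - nbhd G v)"
    using card_nbhd_diff_le assms by (simp add: antisym)
  then show ?thesis
    using card_Int_Diff[OF finite_nbhd, of u "nbhd G v"] card_Int_Diff[OF finite_nbhd, of v "nbhd G u"]
    by (simp add: Int_commute)
qed

section \<open>Functions with zero sum on flats\<close>

text \<open>The flats covering a flat \<open>X\<close> partition the complement of \<open>X\<close>. If \<open>f\<close> sums to zero on each
  of these \<open>m\<close> covers and on the whole vertex set, its sum over \<open>X\<close> is therefore multiplied by
  \<open>m\<close>, so it vanishes unless \<open>m = 1\<close>, that is, unless \<open>X\<close> is a hyperplane.\<close>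

lemma sum_flat_eq_0:
  fixes f :: "'a \<Rightarrow> real"
  assumes V0: "sum f (verts G) = 0" and N0: "\<And>u. u \<in> verts G \<Longrightarrow> sum f (nbhd G u) = 0"
    and "S \<subseteq> verts G"
  shows "sum f {v \<in> verts G. nbhd G v \<subseteq> nbhds S} = 0"
  using assms(3)
proof (induction "card (verts G - nbhds S)" arbitrary: S rule: less_induct)
  case less
  note S = less.prems
  define X where "X = {v \<in> verts G. nbhd G v \<subseteq> nbhds S}"
  define D where "D = verts G - X"
  \<comment> \<open>For \<open>v\<close> in \<open>D\<close>, this is the neighbourhood of the flat
    covering \<open>X\<close> through \<open>v\<close>; the fibres on \<open>D\<close> are the
    covers minus \<open>X\<close>.\<close>
  define h where "h v = nbhd G v \<union> nbhds S" for v
  have fin: "finite X" "finite D" by (auto simp: X_def D_def)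
  have fibre: "sum f {v \<in> D. h v = Z} = - sum f X" if "Z \<in> h ` D" for Z
  proof -
    from that obtain w where w: "w \<in> D" "Z = h w" by (rule imageE) simp
    have wV: "w \<in> verts G" "\<not> nbhd G w \<subseteq> nbhds S" using w by (auto simp: D_def X_def)
    have "sum f {v \<in> verts G. nbhd G v \<subseteq> nbhds (insert w S)} = 0"
    proof (rule less.hyps)
      show "card (verts G - nbhds (insert w S)) < card (verts G - nbhds S)"
        using wV nbhd_subset by (intro psubset_card_mono) auto
      show "insert w S \<subseteq> verts G" using wV S by simp
    qed
    also have "{v \<in> verts G. nbhd G v \<subseteq> nbhds (insert w S)} = X \<union> {v \<in> D. h v = Z}"
    proof (intro equalityI subsetI)
      fix v assume v: "v \<in> {v \<in> verts G. nbhd G v \<subseteq> nbhds (insert w S)}"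
      show "v \<in> X \<union> {v \<in> D. h v = Z}"
      proof (cases "v \<in> X")
        case False
        then have "nbhd G w \<subseteq> nbhd G v \<union> nbhds S"
          using nbhd_exchange[OF S wV(1), of v] v by (auto simp: X_def)
        then show ?thesis using v False w by (auto simp: D_def h_def)
      qed simp
    next
      fix v assume v: "v \<in> X \<union> {v \<in> D. h v = Z}"
      then show "v \<in> {v \<in> verts G. nbhd G v \<subseteq> nbhds (insert w S)}"
        using w by (auto simp: X_def D_def h_def)
    qed
    also have "sum f \<dots> = sum f X + sum f {v \<in> D. h v = Z}"
      using fin by (intro sum.union_disjoint) (auto simp: D_def)
    finally show ?thesis by simp
  qed
  have "sum f (verts G) = sum f X + sum f D"
    using sum.subset_diff[of X "verts G" f] by (auto simp: D_def X_def)
  then have "- sum f X = sum f D" using V0 by simp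
  also have "\<dots> = (\<Sum>Z\<in>h ` D. sum f {v \<in> D. h v = Z})"
    using fin by (intro sum.image_gen)
  also have "\<dots> = - (real (card (h ` D)) * sum f X)"
    using fibre by simp
  finally have eq: "sum f X = real (card (h ` D)) * sum f X" by simp
  have "sum f X = 0"
  proof (cases "card (h ` D) = 1")
    case False
    then show ?thesis using eq by simp
  next
    case True
    then obtain Z where Z: "h ` D = {Z}" by (rule card_1_singletonE)
    have "D \<noteq> {}" using Z by auto
    have "verts G \<subseteq> Z"
    proof
      fix u assume "u \<in> verts G"
      then obtain v where v: "v \<in> verts G" "u \<in> nbhd G v" using nbhds_verts by blast
      show "u \<in> Z"
      proof (cases "v \<in> D")
        case True
        then show ?thesis using v Z by (auto simp: h_def)
      next
        case False
        then have "u \<in> nbhds S" using v by (auto simp: D_def X_def)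
        then show ?thesis using Z by (auto simp: h_def)
      qed
    qed
    have "\<not> verts G \<subseteq> nbhds S"
      using \<open>D \<noteq> {}\<close> nbhd_subset by (auto simp: D_def X_def)
    then obtain u where u: "u \<in> verts G" "u \<notin> nbhds S" by blast
    \<comment> \<open>The complement of a hyperplane is the neighbourhood of any vertex that
      \<open>S\<close> leaves undominated.\<close>
    have "D = nbhd G u"
    proof (intro equalityI subsetI)
      fix v assume v: "v \<in> D"
      then have "u \<in> h v" using Z \<open>verts G \<subseteq> Z\<close> u by blast
      then show "v \<in> nbhd G u" using u nbhd_sym by (auto simp: h_def)
    next
      fix v assume v: "v \<in> nbhd G u"
      then have "u \<in> nbhd G v" using nbhd_sym by blast
      then show "v \<in> D" using u v in_verts_if_nbhd by (auto simp: D_def X_def)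
    qed
    then show ?thesis using N0[OF u(1)] \<open>- sum f X = sum f D\<close> by simp
  qed
  then show ?case by (simp add: X_def)
qed

text \<open>By \<open>nbhd_antichain\<close>, the closure of a single vertex is that vertex
  alone.\<close>

lemma eq_0_if_sum_nbhd_eq_0:
  fixes f :: "'a \<Rightarrow> real"
  assumes "sum f (verts G) = 0" "\<And>u. u \<in> verts G \<Longrightarrow> sum f (nbhd G u) = 0" "v \<in> verts G"
  shows "f v = 0"
proof -
  have "{w \<in> verts G. nbhd G w \<subseteq> nbhds {v}} = {v}"
    using assms(3) nbhd_antichain by auto
  then show ?thesis using sum_flat_eq_0[OF assms(1,2), of "{v}"] assms(3) by simp
qed

section \<open>Excluding two distinct degrees\<close>

text \<open>A bipartition into vertices of degree \<open>a\<close> and vertices of degree \<open>b > a\<close> would make the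
  first part larger than the second, so the biadjacency matrix would have a kernel vector.\<close>

lemma no_biregular_bipartition:
  assumes AB: "verts G = A \<union> B" "A \<inter> B = {}" "A \<noteq> {}"
    and A: "\<And>v. v \<in> A \<Longrightarrow> card (nbhd G v) = a \<and> nbhd G v \<subseteq> B"
    and B: "\<And>v. v \<in> B \<Longrightarrow> card (nbhd G v) = b \<and> nbhd G v \<subseteq> A"
  shows "b \<le> a"
proof (rule ccontr)
  assume "\<not> b \<le> a"
  have fin: "finite A" "finite B" using finite_verts AB(1) by (metis finite_Un)+
  \<comment> \<open>Double counting of edges weighted by \<open>g\<close>: the constant 1 compares
    the sizes of the parts, and a kernel vector gets total sum zero.\<close>
  have swap: "(\<Sum>q\<in>B. sum g (nbhd G q)) = real a * sum g A" for g :: "'a \<Rightarrow> real"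
  proof -
    have "(\<Sum>q\<in>B. sum g (nbhd G q)) = (\<Sum>q\<in>B. \<Sum>v | v \<in> A \<and> v \<in> nbhd G q. g v)"
      using B by (intro sum.cong) auto
    also have "\<dots> = (\<Sum>v\<in>A. \<Sum>q | q \<in> B \<and> v \<in> nbhd G q. g v)"
      by (rule sum.swap_restrict[OF fin(2,1)])
    also have "\<dots> = (\<Sum>v\<in>A. \<Sum>q\<in>nbhd G v. g v)"
      using A nbhd_sym by (intro sum.cong) auto
    also have "\<dots> = real a * sum g A" using A by (simp add: sum_distrib_left)
    finally show ?thesis .
  qed
  obtain v where "v \<in> A" using AB(3) by blast
  then have "a > 0" using A nbhd_nonempty[of v] finite_nbhd[of v] AB(1) by fastforce
  have "real (card B * b) = real a * real (card A)"
    using swap[of "\<lambda>_. 1"] B by simp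
  then have e: "card B * b = a * card A" by (metis of_nat_eq_iff of_nat_mult)
  have "card B < card A"
  proof (rule ccontr)
    assume "\<not> card B < card A"
    then have "a * card A \<le> a * card B" by simp
    also have "\<dots> < card B * b"
    proof -
      have "card A > 0" using fin AB(3) by (simp add: card_gt_0_iff)
      then show ?thesis using \<open>\<not> b \<le> a\<close> \<open>\<not> card B < card A\<close> by simp
    qed
    finally show False using e by simp
  qed
  from homogeneous_system_nontrivial_solution[OF fin(2,1) this,
      of "\<lambda>q v. if v \<in> nbhd G q then 1 else 0"]
  obtain f :: "'a \<Rightarrow> real" where f: "\<exists>v\<in>A. f v \<noteq> 0"
    "\<And>q. q \<in> B \<Longrightarrow> (\<Sum>v\<in>A. (if v \<in> nbhd G q then 1 else 0) * f v) = 0" by blast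
  \<comment> \<open>Extension by zero: vertices of \<open>A\<close> have their neighbours in
    \<open>B\<close>, so their neighbourhood sums vanish too.\<close>
  define g where "g v = (if v \<in> A then f v else 0)" for v
  have gB: "sum g (nbhd G q) = 0" if "q \<in> B" for q
  proof -
    have "sum g (nbhd G q) = (\<Sum>v\<in>A. (if v \<in> nbhd G q then 1 else 0) * f v)"
      using B[OF that] fin by (intro sum.mono_neutral_cong_left) (auto simp: g_def)
    then show ?thesis using f(2)[OF that] by simp
  qed
  have gA: "sum g (nbhd G q) = 0" if "q \<in> A" for q
    using A[OF that] AB(2) by (intro sum.neutral) (auto simp: g_def)
  have "sum g A = 0" using swap[of g] gB \<open>a > 0\<close> by simp
  moreover have "sum g B = 0" using AB(2) by (intro sum.neutral) (auto simp: g_def)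
  ultimately have "sum g (verts G) = 0" using AB fin by (simp add: sum.union_disjoint)
  then have "g v = 0" if "v \<in> A" for v
    using eq_0_if_sum_nbhd_eq_0[of g v] gA gB that AB(1) by auto
  then show False using f(1) by (auto simp: g_def)
qed

lemma regular_if_connected:
  assumes conn: "Digraph_Component.connected G"
  shows "regular G"
proof (cases "verts G = {}")
  case True
  then show ?thesis by (simp add: regular_def)
next
  case False
  then obtain x where x: "x \<in> verts G" by blast
  then obtain y where y: "y \<in> nbhd G x" using nbhd_nonempty by blast
  define a where "a = card (nbhd G x)"
  define b where "b = card (nbhd G y)"
  \<comment> \<open>Degree pattern carried along walks from \<open>x\<close>, with the roles of the
    two degrees swapping at each step.\<close>
  define P where "P a b v \<longleftrightarrow> card (nbhd G v) = a \<and> (\<forall>w\<in>nbhd G v. card (nbhd G w) = b)" for a b v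
  have P: "P a b v \<or> P b a v" if "v \<in> verts G" for v
  proof -
    have "x \<rightarrow>\<^sup>*\<^bsub>G\<^esub> v"
      using conn x that reachable_mk_symmetric_eq[OF sym_arcs, of x v]
      by (simp add: connected_def strongly_connected_def)
    then show ?thesis
    proof (induction rule: reachable_induct)
      case base
      have "\<forall>w\<in>nbhd G x. card (nbhd G w) = b"
        using card_nbhd_eq_if_common_nbhd[OF _ y] by (simp add: b_def)
      then show ?case by (simp add: P_def a_def)
    next
      case (step v w)
      from step.hyps(2) have w: "w \<in> nbhd G v" by (simp add: nbhd_def)
      have "\<forall>z\<in>nbhd G w. card (nbhd G z) = card (nbhd G v)"
        using card_nbhd_eq_if_common_nbhd[of _ w v] w nbhd_sym by blast
      with step.IH w show ?case unfolding P_def by auto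
    qed
  qed
  have "a = b"
  proof (rule ccontr)
    assume "a \<noteq> b"
    define A where "A = {v \<in> verts G. card (nbhd G v) = a}"
    define B where "B = {v \<in> verts G. card (nbhd G v) = b}"
    have V: "verts G = A \<union> B" "A \<inter> B = {}"
      using P \<open>a \<noteq> b\<close> by (auto simp: A_def B_def P_def)
    have ne: "A \<noteq> {}" "B \<noteq> {}"
      using x in_verts_if_nbhd(1)[OF y] unfolding A_def B_def a_def b_def by blast+
    have A: "card (nbhd G v) = a \<and> nbhd G v \<subseteq> B" if "v \<in> A" for v
    proof -
      have "P a b v" using that P[of v] \<open>a \<noteq> b\<close> by (auto simp: A_def B_def P_def)
      then show ?thesis using nbhd_subset[of v] by (auto simp: B_def P_def)
    qed
    have B: "card (nbhd G v) = b \<and> nbhd G v \<subseteq> A" if "v \<in> B" for v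
    proof -
      have "P b a v" using that P[of v] \<open>a \<noteq> b\<close> by (auto simp: A_def B_def P_def)
      then show ?thesis using nbhd_subset[of v] by (auto simp: A_def P_def)
    qed
    have "b \<le> a" by (rule no_biregular_bipartition[OF V ne(1) A B])
    moreover have "a \<le> b"
      by (rule no_biregular_bipartition[of B A, OF _ _ ne(2) B A]) (use V in auto)
    ultimately show False using \<open>a \<noteq> b\<close> by simp
  qed
  then show ?thesis using P unfolding regular_def P_def by blast
qed

end

theorem theorem4p2:
  fixes G :: "('a, 'b) pre_digraph" and k :: nat
  assumes "even k" and "k > 0"
    and "graph G"
    and "Digraph_Component.connected G"
    and "false_twin_free G"
    and "total_uniform k G"
  shows "regular G"
proof -
  interpret graph G by fact
  interpret total_uniform_graph G k by unfold_locales (fact assms)+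
  show ?thesis by (rule regular_if_connected) fact
qed

end
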